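(* Let $\mathit{td}(n)$ be a function of $n$ and let $\mathcal{G}$ be the family of (connected) graphs of tree-depth at most $\mathit{td}(n)$. Let $\delta_{\mathcal{G}}(n)=\max\{\delta(\mathcal{A}(G)) : G\in\mathcal{G},\ |V(G)|=n\}$. Then $\delta_{\mathcal{G}}(n) = \Theta(\mathit{td}(n)\cdot n)$.
   Context: All graphs are finite, simple and connected. For a graph $G=(V,E)$, a search tree on $G$ is a rooted tree with vertex set $V$ defined recursively: its root is some vertex $r\in V$, and $r$ is joined to the roots of search trees on each connected component of $G-r$. The tubes of a search tree are the vertex sets of its subtrees. Two search trees on $G$ are related by a rotation if their sets of tubes have symmetric difference of size exactly two. The graph associahedron $\mathcal{A}(G)$ is a polytope whose skeleton is isomorphic to the graph on search trees of $G$ with adjacency given by rotations; $\delta(\mathcal{A}(G))$ is the diameter of this graph. The tree-depth of $G$ is the minimum height of a search tree on $G$, where a tree consisting of a single vertex has height one.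
   Formalization: The function td(n) is assumed to satisfy 2 ≤ td(n) ≤ n for all large n: for td(n) < 2 and n ≥ 2 the family has no graph on n vertices, and for td(n) = n² the claim fails, since the diameter is O(n²). *)

theory Defs
  imports
    "Graph_Theory.Graph_Theory"
    "HOL-Library.FSet"
    "HOL-Library.Landau_Symbols"
begin

text \<open>
  Graphs are the symmetric, loop-free finite digraphs of \<^locale>\<open>pair_graph\<close> (one arc in each
  direction for every edge). On symmetric digraphs, \<^const>\<open>pre_digraph.sccs\<close> is the set of
  connected components, each given as an induced subgraph.
\<close>

datatype (tree_verts: 'a) rooted_tree = Node 'a "'a rooted_tree fset"

text \<open>\<open>t H\<close> is the search tree chosen on the component \<open>H\<close> of \<open>G - r\<close>.\<close>

inductive search_tree :: "('a, 'b) pre_digraph \<Rightarrow> 'a rooted_tree \<Rightarrow> bool" where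
  "\<lbrakk> r \<in> verts G;
     \<And>H. H \<in> pre_digraph.sccs (pre_digraph.del_vert G r) \<Longrightarrow> search_tree H (t H);
     fset Ts = t ` pre_digraph.sccs (pre_digraph.del_vert G r) \<rbrakk>
   \<Longrightarrow> search_tree G (Node r Ts)"

primrec tubes :: "'a rooted_tree \<Rightarrow> 'a set set" where
  "tubes (Node r Ts) = insert (tree_verts (Node r Ts)) (\<Union> (fset (tubes |`| Ts)))"

primrec height :: "'a rooted_tree \<Rightarrow> nat" where
  "height (Node r Ts) = Suc (Max (insert 0 (fset (height |`| Ts))))"

definition tree_depth :: "('a, 'b) pre_digraph \<Rightarrow> nat" where
  "tree_depth G = (LEAST h. \<exists>T. search_tree G T \<and> height T = h)"

definition rotation :: "'a rooted_tree \<Rightarrow> 'a rooted_tree \<Rightarrow> bool" where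
  "rotation S T \<longleftrightarrow> card ((tubes S - tubes T) \<union> (tubes T - tubes S)) = 2"

definition rotation_graph :: "('a, 'b) pre_digraph \<Rightarrow> 'a rooted_tree pair_pre_digraph" where
  "rotation_graph G =
     \<lparr> pverts = {T. search_tree G T},
       parcs = {(S, T). search_tree G S \<and> search_tree G T \<and> rotation S T} \<rparr>"

definition graph_distance :: "('a, 'b) pre_digraph \<Rightarrow> 'a \<Rightarrow> 'a \<Rightarrow> nat" where
  "graph_distance G u v = (LEAST k. \<exists>p. pre_digraph.awalk G u p v \<and> length p = k)"

definition graph_diameter :: "('a, 'b) pre_digraph \<Rightarrow> nat" where
  "graph_diameter G = Max {graph_distance G u v | u v. u \<in> verts G \<and> v \<in> verts G}"

text \<open>The diameter of the skeleton of the graph associahedron of \<open>G\<close>.\<close>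

definition associahedron_diameter :: "('a, 'b) pre_digraph \<Rightarrow> nat" where
  "associahedron_diameter G = graph_diameter (with_proj (rotation_graph G))"

text \<open>
  Every finite graph is isomorphic to one whose vertices are natural numbers, so the maximum
  below covers all graphs of order \<open>n\<close>.
\<close>

definition max_diameter :: "(nat \<Rightarrow> real) \<Rightarrow> nat \<Rightarrow> nat" where
  "max_diameter td n =
     Max {associahedron_diameter (with_proj G) | G :: nat pair_pre_digraph.
            pair_graph G \<and> connected (with_proj G) \<and>
            real (tree_depth (with_proj G)) \<le> td n \<and> card (pverts G) = n}"

lemma tree_verts_search_tree:
  assumes "search_tree G T" "wf_digraph G"
  shows "tree_verts T = verts G"
  using assms
proof (induction rule: search_tree.induct)
  case (1 r G t Ts)
  interpret G: wf_digraph G by fact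
  interpret D: wf_digraph "pre_digraph.del_vert G r" by (rule G.wf_digraph_del_vert)
  have "tree_verts (t H) = verts H" if H: "H \<in> D.sccs" for H
    using "1.IH"[OF H] D.in_sccs_imp_induced[OF H]
    by (auto simp: induced_subgraph_def subgraph_def)
  then have "tree_verts (Node r Ts) = insert r (\<Union> (verts ` D.sccs))"
    using "1.hyps" by simp
  also have "\<Union> (verts ` D.sccs) = verts (pre_digraph.del_vert G r)"
    unfolding D.sccs_verts_conv[symmetric] D.sccs_verts_conv_scc_of
    using D.in_scc_of_self D.sccs_verts_subsets D.scc_of_in_sccs_verts by blast
  finally show ?case
    using "1.hyps" by (auto simp: G.verts_del_vert)
qed

end

theory Submission
  imports Defs
begin

text \<open>
  Upper bound: in any search tree a chosen vertex can be rotated to the root, using at most one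
  rotation per vertex. Doing this for the root of a search tree \<open>T\<close> of minimum height, and then
  recursively inside the components, turns every search tree into \<open>T\<close>; each level of \<open>T\<close> costs at
  most \<open>n\<close> rotations, so any two search trees are at distance at most \<open>2 * height T * n\<close>.

  Lower bound: the ends of an edge are comparable in every search tree, and a rotation reverses
  the order of the ends of at most one edge. Take a clique of \<open>k\<close> vertices joined completely to
  \<open>n - k\<close> independent vertices. Its tree-depth is at most \<open>k + 1\<close>, and a search tree with the
  clique on top differs on \<open>k * (n - k)\<close> edges from one with the independent vertices on top.
\<close>

section \<open>Connected components of induced subgraphs\<close>

locale undirected =
  fixes E :: "'a rel"
  assumes sym_E: "sym E"
begin

text \<open>
  Connectedness is expressed by cuts rather than by walks: no proper nonempty part is closed under
  adjacency. This makes the effect of vertex deletion on components a matter of set algebra.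
\<close>

definition conn :: "'a set \<Rightarrow> bool" where
  "conn C \<longleftrightarrow> C \<noteq> {} \<and> (\<forall>A \<subseteq> C. A \<noteq> {} \<longrightarrow> E `` A \<inter> C \<subseteq> A \<longrightarrow> A = C)"

definition comps :: "'a set \<Rightarrow> 'a set set" where
  "comps U = {C. C \<subseteq> U \<and> conn C \<and> E `` C \<inter> U \<subseteq> C}"

text \<open>Arcs are vertex pairs, exactly as in \<open>with_proj\<close>, so a pair graph with arc
  set \<open>E\<close> equals \<open>induced\<close> of its vertex set, and its components are again
  of this form.\<close>

definition induced :: "'a set \<Rightarrow> ('a, 'a \<times> 'a) pre_digraph" where
  "induced U = \<lparr>verts = U, arcs = E \<inter> U \<times> U, tail = fst, head = snd\<rparr>"

abbreviation st :: "'a set \<Rightarrow> 'a rooted_tree \<Rightarrow> bool" where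
  "st U \<equiv> search_tree (induced U)"

lemma connD: "conn C \<Longrightarrow> A \<subseteq> C \<Longrightarrow> A \<noteq> {} \<Longrightarrow> E `` A \<inter> C \<subseteq> A \<Longrightarrow> A = C"
  unfolding conn_def by blast

lemma compsD:
  assumes "C \<in> comps U"
  shows "C \<subseteq> U" "conn C" "E `` C \<inter> U \<subseteq> C" "C \<noteq> {}"
  using assms by (auto simp: comps_def conn_def)

lemma finite_comps: "finite U \<Longrightarrow> finite (comps U)"
  by (rule finite_subset[of _ "Pow U"]) (auto simp: comps_def)

lemma comps_eq:
  assumes "C \<in> comps U" "D \<in> comps U" "x \<in> C" "x \<in> D"
  shows "C = D"
proof -
  have "C \<inter> D = C"
    using assms by (intro connD) (auto simp: comps_def)
  moreover have "C \<inter> D = D"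
    using assms by (intro connD) (auto simp: comps_def)
  ultimately show ?thesis by simp
qed

text \<open>The component of \<open>x\<close> is the least adjacency-closed subset of
  \<open>U\<close> containing \<open>x\<close>. For a closed part of it, either the part or its
  complement contains \<open>x\<close>; by symmetry of \<open>E\<close> the complement is closed
  too, so minimality applies to one of them.\<close>

lemma comps_cover:
  assumes "x \<in> U"
  obtains C where "C \<in> comps U" "x \<in> C"
proof -
  define F where "F = {A. A \<subseteq> U \<and> x \<in> A \<and> E `` A \<inter> U \<subseteq> A}"
  define C where "C = \<Inter>F"
  have "U \<in> F" using assms by (auto simp: F_def)
  then have CU: "C \<subseteq> U" and xC: "x \<in> C" by (auto simp: C_def F_def)
  have cl: "E `` C \<inter> U \<subseteq> C" unfolding C_def F_def by blast
  have min: "A = C" if "A \<subseteq> C" "x \<in> A" "E `` A \<inter> C \<subseteq> A" for A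
  proof -
    have "A \<in> F" using that CU cl unfolding F_def by blast
    then show ?thesis using that by (auto simp: C_def)
  qed
  have "conn C" unfolding conn_def
  proof (intro conjI allI impI)
    fix A assume A: "A \<subseteq> C" "A \<noteq> {}" "E `` A \<inter> C \<subseteq> A"
    show "A = C"
    proof (cases "x \<in> A")
      case False
      have "E `` (C - A) \<inter> C \<subseteq> C - A" using A sym_E by (auto dest: symD)
      then have "C - A = C" using False xC by (intro min) auto
      then show ?thesis using A by auto
    qed (use A min in blast)
  qed (use xC in auto)
  then show thesis using that CU cl xC unfolding comps_def by blast
qed

lemma comps_edge: "C \<in> comps U \<Longrightarrow> u \<in> C \<Longrightarrow> (u, v) \<in> E \<Longrightarrow> v \<in> U \<Longrightarrow> v \<in> C"
  unfolding comps_def by blast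

lemma comps_empty: "comps {} = {}"
  unfolding comps_def conn_def by blast

text \<open>Only the component \<open>C0\<close> of \<open>r\<close> is affected: a component of
  \<open>W - {r}\<close> that misses \<open>C0\<close> has no edge to \<open>r\<close>, and one that
  meets \<open>C0\<close> lies inside it. \<open>reach_root\<close> uses this for both orders of
  deleting two vertices.\<close>

lemma comps_del:
  assumes "C0 \<in> comps W" "r \<in> C0"
  shows "comps (W - {r}) = (comps W - {C0}) \<union> comps (C0 - {r})"
proof (intro equalityI subsetI)
  fix C assume C: "C \<in> comps (W - {r})"
  show "C \<in> (comps W - {C0}) \<union> comps (C0 - {r})"
  proof (cases "C \<inter> C0 = {}")
    case True
    have "r \<notin> E `` C"
      using True assms(2) symD[OF sym_E] comps_edge[OF assms] compsD(1)[OF C] compsD(1)[OF assms(1)]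
      by blast
    then have "C \<in> comps W" using C by (auto simp: comps_def)
    then show ?thesis using True compsD(4)[OF C] by auto
  next
    case False
    have "C \<inter> C0 = C"
      using C assms False by (intro connD) (auto simp: comps_def)
    then show ?thesis using C assms by (auto simp: comps_def)
  qed
next
  fix C assume "C \<in> (comps W - {C0}) \<union> comps (C0 - {r})"
  then show "C \<in> comps (W - {r})"
  proof
    assume C: "C \<in> comps W - {C0}"
    then have "r \<notin> C" using assms comps_eq by blast
    then show ?thesis using C by (auto simp: comps_def)
  next
    assume "C \<in> comps (C0 - {r})"
    then show ?thesis using assms unfolding comps_def by blast
  qed
qed

section \<open>Induced subgraphs as digraphs and their strongly connected components\<close>

lemma induced_simps [simp]:
  "verts (induced U) = U" "arcs (induced U) = E \<inter> U \<times> U"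
  "tail (induced U) = fst" "head (induced U) = snd"
  "arcs_ends (induced U) = E \<inter> U \<times> U"
  by (auto simp: induced_def arcs_ends_conv)

lemma wf_induced: "wf_digraph (induced U)"
  by unfold_locales auto

lemma induced_inject [simp]: "induced U = induced V \<longleftrightarrow> U = V"
  by (metis induced_simps(1))

lemma del_vert_induced: "pre_digraph.del_vert (induced U) r = induced (U - {r})"
  by (auto simp: pre_digraph.del_vert_def induced_def)

lemma induced_subgraph_induced_iff:
  "induced_subgraph H (induced U) \<longleftrightarrow> (\<exists>C \<subseteq> U. H = induced C)"
proof
  assume H: "induced_subgraph H (induced U)"
  have "H = induced (verts H)"
    using H by (cases H) (auto simp: induced_subgraph_def subgraph_def compatible_def induced_def)
  then show "\<exists>C \<subseteq> U. H = induced C"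
    using H by (auto simp: induced_subgraph_def subgraph_def)
next
  assume "\<exists>C \<subseteq> U. H = induced C"
  then show "induced_subgraph H (induced U)"
    using wf_induced by (auto simp: induced_subgraph_def subgraph_def compatible_def)
qed

text \<open>A walk cannot leave a set closed under adjacency; conversely the set of vertices
  reachable from \<open>u\<close> is closed, hence all of \<open>C\<close>.\<close>

lemma strongly_connected_induced: "strongly_connected (induced C) \<longleftrightarrow> conn C"
proof
  assume sc: "strongly_connected (induced C)"
  show "conn C" unfolding conn_def
  proof (intro conjI allI impI)
    show "C \<noteq> {}" using sc by (auto simp: strongly_connected_def)
    fix A assume A: "A \<subseteq> C" "A \<noteq> {}" "E `` A \<inter> C \<subseteq> A"
    then obtain a where a: "a \<in> A" by blast
    have "v \<in> A" if "v \<in> C" for v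
    proof -
      have "(a, v) \<in> rtrancl_on C (E \<inter> C \<times> C)"
        using sc that a A by (auto simp: strongly_connected_def reachable_def)
      then show ?thesis by (induction rule: rtrancl_on_induct) (use a A in auto)
    qed
    then show "A = C" using A by auto
  qed
next
  assume c: "conn C"
  show "strongly_connected (induced C)"
    unfolding strongly_connected_def
  proof (intro conjI ballI)
    fix u v assume uv: "u \<in> verts (induced C)" "v \<in> verts (induced C)"
    let ?A = "{v \<in> C. (u, v) \<in> rtrancl_on C (E \<inter> C \<times> C)}"
    have "?A = C"
      by (rule connD[OF c]) (use uv in \<open>auto intro: rtrancl_on_into_rtrancl_on\<close>)
    then show "reachable (induced C) u v" using uv by (auto simp: reachable_def)
  qed (use c in \<open>auto simp: conn_def\<close>)
qed

lemma conn_insert: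
  assumes "conn C" "x \<in> C" "(x, y) \<in> E"
  shows "conn (insert y C)"
  unfolding conn_def
proof (intro conjI allI impI)
  fix A assume A: "A \<subseteq> insert y C" "A \<noteq> {}" "E `` A \<inter> insert y C \<subseteq> A"
  have "x \<in> A" if "y \<in> A" using that A assms symD[OF sym_E] by blast
  then have "A \<inter> C \<noteq> {}" using A assms by blast
  then have "A \<inter> C = C" using A by (intro connD[OF assms(1)]) auto
  then show "A = insert y C" using A assms by auto
qed auto

text \<open>By \<open>conn_insert\<close> a neighbour outside a connected set could be added to it,
  so maximal connected sets are closed. A closed set inside a connected one equals it, so closed
  connected sets are maximal.\<close>

lemma sccs_induced: "pre_digraph.sccs (induced U) = induced ` comps U"
proof -
  have "(C \<subseteq> U \<and> conn C \<and> \<not> (\<exists>C'. C' \<subseteq> U \<and> conn C' \<and> C \<subset> C')) \<longleftrightarrow> C \<in> comps U" for C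
  proof
    assume L: "C \<subseteq> U \<and> conn C \<and> \<not> (\<exists>C'. C' \<subseteq> U \<and> conn C' \<and> C \<subset> C')"
    have "y \<in> C" if "x \<in> C" "(x, y) \<in> E" "y \<in> U" for x y
      using conn_insert[of C x y] L that by blast
    then show "C \<in> comps U" using L by (auto simp: comps_def)
  next
    assume C: "C \<in> comps U"
    have "\<not> C \<subset> C'" if "C' \<subseteq> U" "conn C'" for C'
      using connD[OF that(2), of C] that compsD[OF C] by blast
    then show "C \<subseteq> U \<and> conn C \<and> \<not> (\<exists>C'. C' \<subseteq> U \<and> conn C' \<and> C \<subset> C')"
      using C by (auto simp: comps_def)
  qed
  then have "comps U = {C. C \<subseteq> U \<and> conn C \<and> \<not> (\<exists>C'. C' \<subseteq> U \<and> conn C' \<and> C \<subset> C')}"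
    by blast
  moreover have "H \<in> pre_digraph.sccs (induced U) \<longleftrightarrow>
      (\<exists>C. H = induced C \<and> C \<subseteq> U \<and> conn C \<and> \<not> (\<exists>C'. C' \<subseteq> U \<and> conn C' \<and> C \<subset> C'))" for H
  proof -
    have ex: "(\<exists>H'. (\<exists>C' \<subseteq> U. H' = induced C') \<and> Q H') \<longleftrightarrow> (\<exists>C' \<subseteq> U. Q (induced C'))" for Q
      by blast
    show ?thesis
    proof (cases "\<exists>C \<subseteq> U. H = induced C")
      case True
      then obtain C where "C \<subseteq> U" "H = induced C" by blast
      then show ?thesis
        unfolding pre_digraph.sccs_def induced_subgraph_induced_iff mem_Collect_eq ex
        by (simp add: strongly_connected_induced)
    next
      case False
      then show ?thesis
        unfolding pre_digraph.sccs_def induced_subgraph_induced_iff by blast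
    qed
  qed
  ultimately have "H \<in> pre_digraph.sccs (induced U) \<longleftrightarrow> (\<exists>C. H = induced C \<and> C \<in> comps U)" for H
    by (simp only: mem_Collect_eq)
  then show ?thesis by (intro set_eqI) (simp only: image_iff Bex_def conj_commute)
qed

section \<open>Search trees and their tubes\<close>

text \<open>Indexing the subtrees by component vertex sets turns the replacement of one subtree into
  a function update.\<close>

definition join :: "'a \<Rightarrow> ('a set \<Rightarrow> 'a rooted_tree) \<Rightarrow> 'a set set \<Rightarrow> 'a rooted_tree" where
  "join r t Cs = Node r (Abs_fset (t ` Cs))"

lemma fset_Abs_fset_image [simp]: "finite Cs \<Longrightarrow> fset (Abs_fset (t ` Cs)) = t ` Cs"
  by (simp add: Abs_fset_inverse)

lemma join_cong: "(\<And>C. C \<in> Cs \<Longrightarrow> t C = t' C) \<Longrightarrow> join r t Cs = join r t' Cs"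
  by (simp add: join_def cong: image_cong)

lemma st_joinI:
  assumes "finite U" "r \<in> U" "\<And>C. C \<in> comps (U - {r}) \<Longrightarrow> st C (t C)"
  shows "st U (join r t (comps (U - {r})))"
  unfolding join_def
  by (rule search_tree.intros[where t = "\<lambda>H. t (verts H)"])
    (use assms in \<open>auto simp: del_vert_induced sccs_induced finite_comps image_image\<close>)

lemma st_joinE:
  assumes "st U T" "finite U"
  obtains r t where "r \<in> U" "T = join r t (comps (U - {r}))"
    "\<And>C. C \<in> comps (U - {r}) \<Longrightarrow> st C (t C)"
  using assms(1)
proof cases
  case (1 r t Ts)
  have "Ts = Abs_fset (fset Ts)" by (simp add: fset_inverse)
  also have "fset Ts = (t \<circ> induced) ` comps (U - {r})"
    using 1 by (auto simp: del_vert_induced sccs_induced)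
  finally have "T = join r (t \<circ> induced) (comps (U - {r}))"
    using 1 by (simp add: join_def)
  then show thesis
    using 1 by (intro that[of r "t \<circ> induced"]) (auto simp: del_vert_induced sccs_induced)
qed

lemma st_induct [consumes 2, case_names join]:
  assumes "finite U" "st U T"
    and step: "\<And>U r t. finite U \<Longrightarrow> r \<in> U \<Longrightarrow>
      (\<And>C. C \<in> comps (U - {r}) \<Longrightarrow> st C (t C)) \<Longrightarrow>
      (\<And>C. C \<in> comps (U - {r}) \<Longrightarrow> P C (t C)) \<Longrightarrow> P U (join r t (comps (U - {r})))"
  shows "P U T"
  using assms(1,2)
proof (induction U arbitrary: T rule: finite_psubset_induct)
  case (psubset U)
  obtain r t where T: "r \<in> U" "T = join r t (comps (U - {r}))"
    "\<And>C. C \<in> comps (U - {r}) \<Longrightarrow> st C (t C)"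
    using st_joinE[OF psubset.prems psubset.hyps] by metis
  have "P C (t C)" if "C \<in> comps (U - {r})" for C
    using psubset.IH T that compsD(1)[OF that] by blast
  then show ?case using T step[OF psubset.hyps] by blast
qed

lemma tree_verts_st: "st U T \<Longrightarrow> tree_verts T = U"
  using tree_verts_search_tree wf_induced by force

lemma tubes_join:
  assumes "finite U" "r \<in> U" "\<And>C. C \<in> comps (U - {r}) \<Longrightarrow> st C (t C)"
  shows "tubes (join r t (comps (U - {r}))) = insert U (\<Union>C \<in> comps (U - {r}). tubes (t C))"
  using tree_verts_st[OF st_joinI[OF assms]] assms(1)
  by (simp add: join_def finite_comps)

lemma tubes_st:
  assumes "finite U" "st U T" "X \<in> tubes T"
  shows "X \<subseteq> U" "X \<noteq> {}"
proof -
  have "\<forall>X \<in> tubes T. X \<subseteq> U \<and> X \<noteq> {}"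
    using assms(1,2)
  proof (induction rule: st_induct)
    case (join U r t)
    have tj: "tubes (join r t (comps (U - {r}))) = insert U (\<Union>C \<in> comps (U - {r}). tubes (t C))"
      using tubes_join join.hyps by blast
    show ?case using join.hyps(2) join.IH compsD(1) unfolding tj by blast
  qed
  then show "X \<subseteq> U" "X \<noteq> {}" using assms(3) by auto
qed

text \<open>For a vertex \<open>v\<close> of a search tree this says that \<open>u\<close> is not in
  the subtree rooted at \<open>v\<close>. It holds in both directions for incomparable vertices;
  between the ends of an edge, which are always comparable, it is the strict ancestor
  relation.\<close>

definition above :: "'a rooted_tree \<Rightarrow> 'a \<Rightarrow> 'a \<Rightarrow> bool" where
  "above T u v \<longleftrightarrow> (\<exists>X \<in> tubes T. v \<in> X \<and> u \<notin> X)"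

text \<open>The minimal tube containing \<open>v\<close> is the vertex set of the subtree rooted at \<open>v\<close>.\<close>

lemma minimal_tube:
  assumes "finite U" "st U T" "v \<in> U"
  shows "\<exists>X \<in> tubes T. v \<in> X \<and> (\<forall>Y \<in> tubes T. v \<in> Y \<longrightarrow> X \<subseteq> Y)"
  using assms
proof (induction arbitrary: v rule: st_induct)
  case (join U r t)
  have sub: "X \<subseteq> C" if "C \<in> comps (U - {r})" "X \<in> tubes (t C)" for X C
    using tubes_st(1) join.hyps that compsD(1)[OF that(1)] by (meson finite_Diff finite_subset)
  have tj: "tubes (join r t (comps (U - {r}))) = insert U (\<Union>C \<in> comps (U - {r}). tubes (t C))"
    using tubes_join join.hyps by blast
  show ?case
  proof (cases "v = r")
    case True
    have "Y = U" if "Y \<in> tubes (join r t (comps (U - {r})))" "v \<in> Y" for Y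
      using that sub compsD(1) True unfolding tj by blast
    then show ?thesis using join.prems tj by blast
  next
    case False
    then obtain C where C: "C \<in> comps (U - {r})" "v \<in> C"
      using comps_cover[of v "U - {r}"] join.prems by auto
    then obtain X where X: "X \<in> tubes (t C)" "v \<in> X" "\<forall>Y \<in> tubes (t C). v \<in> Y \<longrightarrow> X \<subseteq> Y"
      using join.IH by blast
    have "X \<subseteq> Y" if Y: "Y \<in> tubes (join r t (comps (U - {r})))" "v \<in> Y" for Y
    proof (cases "Y = U")
      case True
      then show ?thesis using sub[OF C(1) X(1)] compsD(1)[OF C(1)] by blast
    next
      case False
      then obtain D where D: "D \<in> comps (U - {r})" "Y \<in> tubes (t D)"
        using Y unfolding tj by blast
      then have "D = C" using sub[OF D] Y(2) comps_eq[OF D(1) C(1) _ C(2)] by blast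
      then show ?thesis using X D Y by blast
    qed
    then show ?thesis using X C unfolding tj by blast
  qed
qed

lemma above_total:
  assumes "finite U" "st U T" "u \<in> U" "v \<in> U" "u \<noteq> v"
  shows "above T u v \<or> above T v u"
  using assms
proof (induction arbitrary: u v rule: st_induct)
  case (join U r t)
  have sub: "X \<subseteq> C" if "C \<in> comps (U - {r})" "X \<in> tubes (t C)" for X C
    using tubes_st(1) join.hyps that compsD(1)[OF that(1)] by (meson finite_Diff finite_subset)
  have tj: "tubes (join r t (comps (U - {r}))) = insert U (\<Union>C \<in> comps (U - {r}). tubes (t C))"
    using tubes_join join.hyps by blast
  have C: "C \<in> tubes (t C)" if "C \<in> comps (U - {r})" for C
    using tree_verts_st[OF join.hyps(3)[OF that]] by (cases "t C") auto
  \<comment> \<open>If \<open>a\<close> is outside the component \<open>D\<close> of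
    \<open>b\<close>, the tube \<open>D\<close> separates them. Of two distinct vertices at most one
    is the root, so the other can play \<open>b\<close>.\<close>
  have *: "above (join r t (comps (U - {r}))) a b \<or> above (join r t (comps (U - {r}))) b a"
    if ab: "a \<in> U" "b \<in> U" "a \<noteq> b" "b \<noteq> r" for a b
  proof -
    obtain D where D: "D \<in> comps (U - {r})" "b \<in> D"
      using comps_cover[of b "U - {r}"] ab by auto
    show ?thesis
    proof (cases "a \<in> D")
      case True
      then have "above (t D) a b \<or> above (t D) b a" using join.IH[OF D(1)] D ab by blast
      then show ?thesis using D unfolding above_def tj by blast
    next
      case False
      then show ?thesis using C[OF D(1)] D unfolding above_def tj by blast
    qed
  qed
  show ?case using *[of u v] *[of v u] join.prems by metis
qed

text \<open>Adjacency excludes incomparable pairs: two opposite separating tubes would lie in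
  components containing \<open>v\<close> and \<open>u\<close>, and the edge forces these components
  to coincide, which moves the contradiction down the tree.\<close>

lemma above_antisym:
  assumes "finite U" "st U T" "u \<in> U" "v \<in> U" "(u, v) \<in> E" "above T u v"
  shows "\<not> above T v u"
  using assms
proof (induction rule: st_induct)
  case (join U r t)
  have sub: "X \<subseteq> C" if "C \<in> comps (U - {r})" "X \<in> tubes (t C)" for X C
    using tubes_st(1) join.hyps that compsD(1)[OF that(1)] by (meson finite_Diff finite_subset)
  have tj: "tubes (join r t (comps (U - {r}))) = insert U (\<Union>C \<in> comps (U - {r}). tubes (t C))"
    using tubes_join join.hyps by blast
  show ?case
  proof
    assume a: "above (join r t (comps (U - {r}))) v u"
    obtain X C where X: "C \<in> comps (U - {r})" "X \<in> tubes (t C)" "v \<in> X" "u \<notin> X"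
      using join.prems unfolding above_def tj by blast
    obtain Y D where Y: "D \<in> comps (U - {r})" "Y \<in> tubes (t D)" "u \<in> Y" "v \<notin> Y"
      using a join.prems unfolding above_def tj by blast
    have "v \<in> C" "u \<in> D" using X Y sub by blast+
    moreover have "v \<in> D"
      using comps_edge[OF Y(1) \<open>u \<in> D\<close> join.prems(3)] \<open>v \<in> C\<close> compsD(1)[OF X(1)] by blast
    ultimately have "C = D" using comps_eq X Y by blast
    then show False
      using join.IH[OF X(1)] X Y \<open>v \<in> C\<close> \<open>u \<in> D\<close> join.prems unfolding above_def by blast
  qed
qed

section \<open>Rotations and the order of adjacent vertices\<close>

definition flips :: "'a set \<Rightarrow> 'a rooted_tree \<Rightarrow> 'a rooted_tree \<Rightarrow> ('a \<times> 'a) set" where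
  "flips U S T = {(u, v). u \<in> U \<and> v \<in> U \<and> (u, v) \<in> E \<and> above S u v \<and> above T v u}"

lemma minimal_tube_inject:
  assumes "finite U" "st U S" "v \<in> U" "v' \<in> U"
    and v: "\<And>X. X \<in> tubes S \<Longrightarrow> v \<in> X \<Longrightarrow> (\<forall>Y \<in> tubes S. v \<in> Y \<longrightarrow> X \<subseteq> Y) \<Longrightarrow> X = A"
    and v': "\<And>X. X \<in> tubes S \<Longrightarrow> v' \<in> X \<Longrightarrow> (\<forall>Y \<in> tubes S. v' \<in> Y \<longrightarrow> X \<subseteq> Y) \<Longrightarrow> X = A"
  shows "v = v'"
proof (rule ccontr)
  assume "v \<noteq> v'"
  then have ab: "above S v v' \<or> above S v' v" using above_total assms by blast
  obtain X where X: "X \<in> tubes S" "v \<in> X" "\<forall>Y \<in> tubes S. v \<in> Y \<longrightarrow> X \<subseteq> Y"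
    using minimal_tube[OF assms(1-3)] by blast
  obtain X' where X': "X' \<in> tubes S" "v' \<in> X'" "\<forall>Y \<in> tubes S. v' \<in> Y \<longrightarrow> X' \<subseteq> Y"
    using minimal_tube[OF assms(1,2,4)] by blast
  have "X = A" "X' = A" using v[OF X] v'[OF X'] by auto
  then show False using ab X X' unfolding above_def by blast
qed

text \<open>
  If \<open>(u, v)\<close> is flipped, then the minimal tube of \<open>v\<close> in \<open>S\<close> and that of \<open>u\<close> in \<open>T\<close> are not shared
  by the two trees, hence they are the two tubes in which the trees differ; this determines \<open>(u, v)\<close>.
\<close>

lemma flips_rotation:
  assumes fin: "finite U" and S: "st U S" and T: "st U T" and rot: "rotation S T"
  shows "card (flips U S T) \<le> 1"
proof -
  have tS: "tubes S \<subseteq> Pow U" and tT: "tubes T \<subseteq> Pow U"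
    using tubes_st fin S T by blast+
  then have finST: "finite (tubes S - tubes T)" "finite (tubes T - tubes S)"
    using fin by (meson finite_Diff finite_Pow_iff finite_subset)+
  have anti: "\<not> (above R u v \<and> above R v u)" if "st U R" "u \<in> U" "v \<in> U" "(u, v) \<in> E" for R u v
    using above_antisym[OF fin] that by blast
  have key: "p = q" if p: "p \<in> flips U S T" and q: "q \<in> flips U S T" for p q
  proof -
    obtain u v where uv: "p = (u, v)" "u \<in> U" "v \<in> U" "(u, v) \<in> E" "above S u v" "above T v u"
      using p by (auto simp: flips_def)
    obtain u' v' where uv': "q = (u', v')" "u' \<in> U" "v' \<in> U" "(u', v') \<in> E" "above S u' v'" "above T v' u'"
      using q by (auto simp: flips_def)
    \<comment> \<open>A tube witnessing \<open>above S u v\<close>, if it were also a tube of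
      \<open>T\<close>, would put \<open>u\<close> and \<open>v\<close> above each other in
      \<open>T\<close>; likewise with the trees exchanged. So both differences are nonempty, and
      total size two makes them singletons.\<close>
    have "tubes S - tubes T \<noteq> {}"
      using uv anti[OF T uv(2,3,4)] unfolding above_def by blast
    moreover have "tubes T - tubes S \<noteq> {}"
      using uv anti[OF S uv(2,3,4)] unfolding above_def by blast
    moreover have "card (tubes S - tubes T) + card (tubes T - tubes S) = 2"
      using rot finST unfolding rotation_def by (subst card_Un_disjoint[symmetric]) auto
    moreover have "card (tubes S - tubes T) \<noteq> 0" "card (tubes T - tubes S) \<noteq> 0"
      using calculation(1,2) finST by simp_all
    ultimately have "card (tubes S - tubes T) = 1 \<and> card (tubes T - tubes S) = 1"
      by linarith
    then obtain A B where AB: "tubes S - tubes T = {A}" "tubes T - tubes S = {B}"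
      by (metis card_1_singletonE)
    have vA: "X = A" if "(a, b) \<in> E" "a \<in> U" "b \<in> U" "above S a b" "above T b a" "X \<in> tubes S" "b \<in> X"
      "\<forall>Y \<in> tubes S. b \<in> Y \<longrightarrow> X \<subseteq> Y" for X a b
    proof -
      have "a \<notin> X" using that unfolding above_def by blast
      then have "X \<notin> tubes T" using anti[OF T that(2,3,1)] that unfolding above_def by blast
      then show ?thesis using AB that by blast
    qed
    have uB: "X = B" if "(a, b) \<in> E" "a \<in> U" "b \<in> U" "above S a b" "above T b a" "X \<in> tubes T" "a \<in> X"
      "\<forall>Y \<in> tubes T. a \<in> Y \<longrightarrow> X \<subseteq> Y" for X a b
    proof -
      have "b \<notin> X" using that unfolding above_def by blast
      then have "X \<notin> tubes S" using anti[OF S that(2,3,1)] that unfolding above_def by blast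
      then show ?thesis using AB that by blast
    qed
    have "v = v'"
      by (rule minimal_tube_inject[OF fin S uv(3) uv'(3), of A]) (use vA uv uv' in blast)+
    moreover have "u = u'"
      by (rule minimal_tube_inject[OF fin T uv(2) uv'(2), of B]) (use uB uv uv' in blast)+
    ultimately show ?thesis using uv uv' by simp
  qed
  show ?thesis
  proof (cases "flips U S T = {}")
    case False
    then obtain p where "flips U S T \<subseteq> {p}" using key by blast
    then show ?thesis using card_mono[of "{p}"] by fastforce
  qed simp
qed

section \<open>Rotation distance as powers of the rotation relation\<close>

definition rot :: "'a set \<Rightarrow> 'a rooted_tree rel" where
  "rot U = {(S, T). st U S \<and> st U T \<and> rotation S T}"

definition reach :: "'a set \<Rightarrow> nat \<Rightarrow> 'a rooted_tree \<Rightarrow> 'a rooted_tree \<Rightarrow> bool" where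
  "reach U m S T \<longleftrightarrow> (\<exists>k \<le> m. (S, T) \<in> rot U ^^ k)"

lemma reach_refl: "reach U m S S"
  unfolding reach_def by (rule exI[of _ 0]) simp

lemma reach_trans: "reach U m R S \<Longrightarrow> reach U n S T \<Longrightarrow> reach U (m + n) R T"
  unfolding reach_def by (meson add_mono relpow_trans)

lemma reach_mono: "reach U m S T \<Longrightarrow> m \<le> n \<Longrightarrow> reach U n S T"
  unfolding reach_def using order_trans by blast

lemma rot_sym: "(S, T) \<in> rot U \<Longrightarrow> (T, S) \<in> rot U"
  unfolding rot_def rotation_def by (auto simp: Un_commute)

lemma reach_sym: "reach U m S T \<Longrightarrow> reach U m T S"
proof -
  have "(T, S) \<in> rot U ^^ k" if "(S, T) \<in> rot U ^^ k" for k
    using that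
  proof (induction k arbitrary: T)
    case (Suc k)
    then obtain M where "(S, M) \<in> rot U ^^ k" "(M, T) \<in> rot U" by auto
    then show ?case using Suc.IH rot_sym relpow_Suc_I2 by metis
  qed auto
  then show "reach U m S T \<Longrightarrow> reach U m T S" unfolding reach_def by blast
qed

lemma relpow_rot_st: "(S, T) \<in> rot U ^^ k \<Longrightarrow> st U S \<Longrightarrow> st U T"
proof (induction k)
  case (Suc k)
  then obtain M where "(M, T) \<in> rot U" by auto
  then show ?case by (simp add: rot_def)
qed simp

lemma reach_st: "reach U m S T \<Longrightarrow> st U S \<Longrightarrow> st U T"
  unfolding reach_def using relpow_rot_st by blast

lemma finite_flips: "finite U \<Longrightarrow> finite (flips U S T)"
  by (rule finite_subset[of _ "U \<times> U"]) (auto simp: flips_def)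

text \<open>An intermediate tree \<open>M\<close> orders the ends of a flipped edge one way or the
  other, so the edge is flipped from \<open>S\<close> to \<open>M\<close> or from \<open>M\<close>
  to \<open>T\<close>. Hence each rotation adds at most one flip.\<close>

lemma card_flips_le:
  assumes "finite U" "st U S" "(S, T) \<in> rot U ^^ k"
  shows "card (flips U S T) \<le> k"
  using assms(3)
proof (induction k arbitrary: T)
  case 0
  then have "flips U S T = {}"
    using above_antisym[OF assms(1,2)] by (auto simp: flips_def)
  then show ?case by simp
next
  case (Suc k)
  then obtain M where M: "(S, M) \<in> rot U ^^ k" "(M, T) \<in> rot U" by auto
  then have stM: "st U M" "st U T" "rotation M T" by (auto simp: rot_def)
  have "flips U S T \<subseteq> flips U S M \<union> flips U M T"
  proof
    fix p assume "p \<in> flips U S T"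
    then obtain u v where p: "p = (u, v)" "u \<in> U" "v \<in> U" "(u, v) \<in> E" "above S u v" "above T v u"
      by (auto simp: flips_def)
    then have "u \<noteq> v" by (auto simp: above_def)
    then show "p \<in> flips U S M \<union> flips U M T"
      using above_total[OF assms(1) stM(1) p(2,3)] p by (auto simp: flips_def)
  qed
  then have "card (flips U S T) \<le> card (flips U S M) + card (flips U M T)"
    using card_mono[of "flips U S M \<union> flips U M T" "flips U S T"]
      card_Un_le[of "flips U S M" "flips U M T"] finite_flips[OF assms(1)] by simp
  then show ?case
    using Suc.IH[OF M(1)] flips_rotation[OF assms(1) stM] by linarith
qed

section \<open>Rotating towards a given search tree\<close>

text \<open>Tubes of a subtree on \<open>C0\<close> are nonempty subsets of \<open>C0\<close>, so
  they differ from \<open>U\<close> and from the tubes on other components. The common part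
  \<open>insert U R\<close> cancels in the symmetric difference.\<close>

lemma rot_lift:
  assumes U: "finite U" "r \<in> U" "\<And>C. C \<in> comps (U - {r}) \<Longrightarrow> st C (t C)"
    and C0: "C0 \<in> comps (U - {r})" and rot: "(t C0, T') \<in> rot C0"
  shows "(join r t (comps (U - {r})), join r (t(C0 := T')) (comps (U - {r}))) \<in> rot U"
proof -
  have T': "st C0 T'" "rotation (t C0) T'" using rot by (auto simp: rot_def)
  have st': "st C ((t(C0 := T')) C)" if "C \<in> comps (U - {r})" for C
    using U(3) T' that by auto
  define R where "R = (\<Union>C \<in> comps (U - {r}) - {C0}. tubes (t C))"
  have fin: "finite C" if "C \<in> comps (U - {r})" for C
    using compsD(1)[OF that] U(1) by (meson finite_Diff finite_subset)
  have t1: "tubes (join r t (comps (U - {r}))) = insert U R \<union> tubes (t C0)"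
    using C0 by (subst tubes_join[OF U]) (auto simp: R_def)
  have t2: "tubes (join r (t(C0 := T')) (comps (U - {r}))) = insert U R \<union> tubes T'"
    using C0 by (subst tubes_join[OF U(1,2) st']) (auto simp: R_def split: if_splits)
  have disj: "X \<notin> insert U R" if "X \<subseteq> C0" "X \<noteq> {}" for X
  proof
    assume "X \<in> insert U R"
    moreover have "X \<noteq> U" using that(1) compsD(1)[OF C0] U(2) by blast
    ultimately obtain C where C: "C \<in> comps (U - {r})" "C \<noteq> C0" "X \<in> tubes (t C)"
      by (auto simp: R_def)
    then have "X \<subseteq> C" using tubes_st(1) fin U(3) by blast
    then show False using that comps_eq[OF C(1) C0] C(2) by blast
  qed
  have "X \<notin> insert U R" if "X \<in> tubes (t C0) \<union> tubes T'" for X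
    using that
  proof
    assume X: "X \<in> tubes (t C0)"
    show ?thesis using disj tubes_st[OF fin[OF C0] U(3)[OF C0] X] by simp
  next
    assume X: "X \<in> tubes T'"
    show ?thesis using disj tubes_st[OF fin[OF C0] T'(1) X] by simp
  qed
  then have "(tubes (t C0) \<union> insert U R) - (tubes T' \<union> insert U R) = tubes (t C0) - tubes T'"
    "(tubes T' \<union> insert U R) - (tubes (t C0) \<union> insert U R) = tubes T' - tubes (t C0)"
    by blast+
  then have "rotation (join r t (comps (U - {r}))) (join r (t(C0 := T')) (comps (U - {r})))"
    using T'(2) unfolding rotation_def t1 t2 by (simp add: Un_commute)
  then show ?thesis
    using st_joinI[OF U] st_joinI[OF U(1,2) st'] unfolding rot_def mem_Collect_eq case_prod_conv
    by blast
qed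

lemma reach_lift:
  assumes U: "finite U" "r \<in> U" "\<And>C. C \<in> comps (U - {r}) \<Longrightarrow> st C (t C)"
    and C0: "C0 \<in> comps (U - {r})" and "reach C0 m (t C0) T'"
  shows "reach U m (join r t (comps (U - {r}))) (join r (t(C0 := T')) (comps (U - {r})))"
proof -
  obtain k where k: "k \<le> m" "(t C0, T') \<in> rot C0 ^^ k" using assms(5) by (auto simp: reach_def)
  have "(join r t (comps (U - {r})), join r (t(C0 := T')) (comps (U - {r}))) \<in> rot U ^^ k"
    using k(2)
  proof (induction k arbitrary: T')
    case (Suc k)
    then obtain M where M: "(t C0, M) \<in> rot C0 ^^ k" "(M, T') \<in> rot C0" by auto
    have "(join r (t(C0 := M)) (comps (U - {r})), join r ((t(C0 := M))(C0 := T')) (comps (U - {r}))) \<in> rot U"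
      using U C0 M by (intro rot_lift) (auto simp: rot_def)
    then show ?case using relpow_Suc_I[OF Suc.IH[OF M(1)]] by (simp only: fun_upd_upd)
  qed simp
  then show ?thesis using k(1) by (auto simp: reach_def)
qed

text \<open>The components are treated one after another and the costs add; \<open>F\<close> below
  collects those already done.\<close>

lemma reach_lift_all:
  assumes U: "finite U" "r \<in> U" "\<And>C. C \<in> comps (U - {r}) \<Longrightarrow> st C (t C)"
    and re: "\<And>C. C \<in> comps (U - {r}) \<Longrightarrow> reach C (m C) (t C) (t' C)"
  shows "reach U (\<Sum>C \<in> comps (U - {r}). m C)
    (join r t (comps (U - {r}))) (join r t' (comps (U - {r})))"
proof -
  have "reach U (\<Sum>C \<in> F. m C) (join r t (comps (U - {r})))
      (join r (\<lambda>C. if C \<in> F then t' C else t C) (comps (U - {r})))"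
    if "F \<subseteq> comps (U - {r})" "finite F" for F
    using that(2,1)
  proof (induction F rule: finite_induct)
    case (insert C F)
    let ?u = "\<lambda>C. if C \<in> F then t' C else t C"
    have step: "reach U (m C) (join r ?u (comps (U - {r}))) (join r (?u(C := t' C)) (comps (U - {r})))"
    proof (rule reach_lift[OF U(1,2)])
      show "st D (?u D)" if "D \<in> comps (U - {r})" for D
        using U(3)[OF that] reach_st[OF re[OF that]] by simp
      show "reach C (m C) (?u C) (t' C)" using re insert by auto
    qed (use insert in auto)
    have eq: "?u(C := t' C) = (\<lambda>D. if D \<in> insert C F then t' D else t D)" by auto
    have "reach U (sum m F) (join r t (comps (U - {r}))) (join r ?u (comps (U - {r})))"
      using insert.IH insert.prems by simp
    from reach_trans[OF this step[unfolded eq]] show ?case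
      using insert.hyps by (simp add: add.commute)
  qed (simp add: reach_refl)
  from this[OF order_refl finite_comps] U(1)
  show ?thesis using join_cong[of "comps (U - {r})" "\<lambda>C. if C \<in> comps (U - {r}) then t' C else t C" t' r]
    by auto
qed

lemma reach_root:
  assumes "finite U" "st U S" "r \<in> U"
  shows "\<exists>t. (\<forall>C \<in> comps (U - {r}). st C (t C)) \<and> reach U (card U) S (join r t (comps (U - {r})))"
  using assms
proof (induction arbitrary: r rule: st_induct)
  case (join U p t)
  show ?case
  proof (cases "r = p")
    case True
    then show ?thesis using join.hyps reach_refl by blast
  next
    case False
    then obtain C0 where C0: "C0 \<in> comps (U - {p})" "r \<in> C0"
      using comps_cover[of r "U - {p}"] join.prems by auto
    obtain D0 where D0: "D0 \<in> comps (U - {r})" "p \<in> D0"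
      using comps_cover[of p "U - {r}"] join.hyps(2) False by auto
    have C0U: "C0 \<subseteq> U - {p}" "finite C0" and D0U: "D0 \<subseteq> U - {r}" "finite D0"
      using compsD(1)[OF C0(1)] compsD(1)[OF D0(1)] join.hyps(1) by (auto intro: finite_subset)
    obtain t1 where t1: "\<And>C. C \<in> comps (C0 - {r}) \<Longrightarrow> st C (t1 C)"
      "reach C0 (card C0) (t C0) (join r t1 (comps (C0 - {r})))"
      using join.IH[OF C0] by blast
    txt \<open>
      Once \<open>r\<close> is the root of the subtree on \<open>C0\<close>, exchanging \<open>r\<close> and \<open>p\<close> at the top leaves the
      subtrees on the components of \<open>U - {p, r}\<close> unchanged and replaces the tube \<open>C0\<close> by \<open>D0\<close>.
    \<close>
    define M where "M = comps (U - {p} - {r})"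
    have M1: "M = (comps (U - {p}) - {C0}) \<union> comps (C0 - {r})"
      unfolding M_def by (rule comps_del[OF C0])
    have "U - {p} - {r} = U - {r} - {p}" by blast
    then have M2: "M = (comps (U - {r}) - {D0}) \<union> comps (D0 - {p})"
      unfolding M_def using comps_del[OF D0] by simp
    \<comment> \<open>\<open>q\<close> gives the subtrees on the components of
      \<open>U - {p, r}\<close>: the pieces of \<open>C0\<close> come from its rerooted subtree, all
      others keep their tree.\<close>
    define q where "q C = (if C \<in> comps (C0 - {r}) then t1 C else t C)" for C
    have stq: "st C (q C)" if "C \<in> M" for C
      using that t1(1) join.hyps(3) unfolding M1 q_def by auto
    have q_t: "q C = t C" if C: "C \<in> comps (U - {p}) - {C0}" for C
    proof -
      have "C \<notin> comps (C0 - {r})"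
      proof
        assume "C \<in> comps (C0 - {r})"
        then have "C \<subseteq> C0" "C \<noteq> {}" using compsD(1,4) by blast+
        then show False using comps_eq[OF _ C0(1)] C by blast
      qed
      then show ?thesis by (simp add: q_def)
    qed
    \<comment> \<open>\<open>?S1\<close> and \<open>?S2\<close> will share exactly \<open>U\<close>
      and \<open>N\<close>. No tube in \<open>N\<close> contains \<open>p\<close> or
      \<open>r\<close>, whereas \<open>C0\<close> contains \<open>r\<close> and \<open>D0\<close>
      contains \<open>p\<close>.\<close>
    define N where "N = (\<Union>C \<in> M. tubes (q C))"
    have NU: "X \<subseteq> U - {p} - {r}" if "X \<in> N" for X
    proof -
      obtain C where C: "C \<in> M" "X \<in> tubes (q C)" using \<open>X \<in> N\<close> by (auto simp: N_def)
      then have "C \<subseteq> U - {p} - {r}" using compsD(1) by (auto simp: M_def)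
      moreover from this have "finite C" using join.hyps(1) by (meson finite_Diff finite_subset)
      ultimately show ?thesis using tubes_st(1)[OF _ stq[OF C(1)] C(2)] by blast
    qed
    let ?T0 = "join r t1 (comps (C0 - {r}))"
    let ?S1 = "join p (t(C0 := ?T0)) (comps (U - {p}))"
    have stT0: "st C0 ?T0" by (rule st_joinI[OF C0U(2) C0(2) t1(1)])
    have st1: "st C ((t(C0 := ?T0)) C)" if "C \<in> comps (U - {p})" for C
      using stT0 join.hyps(3) that by auto
    have r1: "reach U (card C0) (join p t (comps (U - {p}))) ?S1"
      by (rule reach_lift[OF join.hyps C0(1) t1(2)])
    have "tubes ?T0 = insert C0 (\<Union>C \<in> comps (C0 - {r}). tubes (q C))"
      by (subst tubes_join[OF C0U(2) C0(2) t1(1)]) (simp_all add: q_def)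
    moreover have "tubes ?S1 = insert U (tubes ?T0 \<union> (\<Union>C \<in> comps (U - {p}) - {C0}. tubes (q C)))"
      using C0(1) q_t by (subst tubes_join[OF join.hyps(1,2) st1]) (auto split: if_splits)
    ultimately have tS1: "tubes ?S1 = insert C0 (insert U N)"
      unfolding N_def M1 by auto
    let ?V0 = "join p q (comps (D0 - {p}))"
    let ?S2 = "join r (q(D0 := ?V0)) (comps (U - {r}))"
    have stq': "st C (q C)" if "C \<in> comps (D0 - {p})" for C using stq that M2 by blast
    have stV0: "st D0 ?V0" by (rule st_joinI[OF D0U(2) D0(2) stq'])
    have st2: "st C ((q(D0 := ?V0)) C)" if "C \<in> comps (U - {r})" for C
      using stV0 stq that M2 by auto
    have "tubes ?V0 = insert D0 (\<Union>C \<in> comps (D0 - {p}). tubes (q C))"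
      by (rule tubes_join[OF D0U(2) D0(2) stq'])
    moreover have "tubes ?S2 = insert U (tubes ?V0 \<union> (\<Union>C \<in> comps (U - {r}) - {D0}. tubes (q C)))"
      using D0(1) by (subst tubes_join[OF join.hyps(1) join.prems st2]) (auto split: if_splits)
    ultimately have tS2: "tubes ?S2 = insert D0 (insert U N)"
      unfolding N_def M2 by auto
    have "C0 \<notin> insert U N" "D0 \<notin> insert U N" "C0 \<noteq> D0"
      using NU C0 C0U D0 D0U join.hyps(2) join.prems by blast+
    then have "(tubes ?S1 - tubes ?S2) \<union> (tubes ?S2 - tubes ?S1) = {C0, D0}"
      unfolding tS1 tS2 by blast
    then have "rotation ?S1 ?S2" using \<open>C0 \<noteq> D0\<close> by (simp add: rotation_def)
    then have "(?S1, ?S2) \<in> rot U"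
      using st_joinI[OF join.hyps(1,2) st1] st_joinI[OF join.hyps(1) join.prems st2]
      unfolding rot_def mem_Collect_eq case_prod_conv by blast
    then have "reach U 1 ?S1 ?S2" unfolding reach_def by (intro exI[of _ 1]) simp
    then have "reach U (card C0 + 1) (join p t (comps (U - {p}))) ?S2"
      using r1 reach_trans by blast
    \<comment> \<open>\<open>C0\<close> misses the old root \<open>p\<close>, which leaves room for
      the final rotation.\<close>
    moreover have "card C0 + 1 \<le> card U"
      using psubset_card_mono[of U C0] join.hyps(1,2) C0U by fastforce
    ultimately show ?thesis using st2 reach_mono by blast
  qed
qed

lemma height_join:
  assumes "finite U"
  shows "height (join r t (comps U)) = Suc (Max (insert 0 ((\<lambda>C. height (t C)) ` comps U)))"
  using finite_comps[OF assms] by (simp add: join_def image_image)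

lemma sum_card_comps: "finite U \<Longrightarrow> (\<Sum>C \<in> comps U. card C) \<le> card U"
proof -
  assume U: "finite U"
  have "card (\<Union> (comps U)) = (\<Sum>C \<in> comps U. card C)"
  proof (rule card_Union_disjoint)
    show "pairwise disjnt (comps U)" unfolding pairwise_def disjnt_def using comps_eq by blast
  qed (use U compsD(1) finite_subset in blast)
  moreover have "card (\<Union> (comps U)) \<le> card U"
    using U compsD(1) by (intro card_mono) blast+
  ultimately show ?thesis by simp
qed

text \<open>Bringing the root of \<open>T\<close> to the top costs at most \<open>card U\<close>.
  The components below are disjoint and their trees have height at most \<open>height T - 1\<close>,
  so the remaining cost is at most \<open>(height T - 1) * card U\<close>.\<close>

lemma reach_height:
  assumes "finite U" "st U T" "st U S"
  shows "reach U (height T * card U) S T"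
  using assms
proof (induction arbitrary: S rule: st_induct)
  case (join U r t)
  let ?Cs = "comps (U - {r})" let ?T = "join r t (comps (U - {r}))"
  obtain s where s: "\<And>C. C \<in> ?Cs \<Longrightarrow> st C (s C)" "reach U (card U) S (join r s ?Cs)"
    using reach_root[OF join.hyps(1) join.prems join.hyps(2)] by blast
  have "reach U (\<Sum>C \<in> ?Cs. height (t C) * card C) (join r s ?Cs) ?T"
    using join.IH s(1) by (intro reach_lift_all[OF join.hyps(1,2)]) auto
  then have re: "reach U (card U + (\<Sum>C \<in> ?Cs. height (t C) * card C)) S ?T"
    using reach_trans s(2) by blast
  have h: "Suc (height (t C)) \<le> height ?T" if "C \<in> ?Cs" for C
    using that finite_comps[of "U - {r}"] join.hyps(1)
    by (subst height_join) (auto intro!: Max_ge)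
  have "(\<Sum>C \<in> ?Cs. height (t C) * card C) \<le> (\<Sum>C \<in> ?Cs. (height ?T - 1) * card C)"
    using h by (intro sum_mono mult_right_mono) fastforce+
  also have "\<dots> \<le> (height ?T - 1) * card (U - {r})"
    using sum_card_comps[of "U - {r}"] join.hyps(1) by (simp flip: sum_distrib_left)
  also have "\<dots> \<le> (height ?T - 1) * card U"
    using join.hyps(1) by (intro mult_left_mono card_mono) auto
  finally have "card U + (\<Sum>C \<in> ?Cs. height (t C) * card C) \<le> (1 + (height ?T - 1)) * card U"
    by (simp add: algebra_simps)
  also have "1 + (height ?T - 1) = height ?T" using join.hyps(1) by (simp add: height_join)
  finally show ?case using re reach_mono by blast
qed

section \<open>Diameter bounds\<close>

text \<open>The search tree is obtained by choosing the root in \<open>K\<close> whenever possible.\<close>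

lemma search_tree_exists:
  assumes "finite U" "U \<noteq> {}"
  shows "\<exists>T. st U T \<and> (\<forall>c \<in> U \<inter> K. \<forall>v \<in> U - K. (c, v) \<in> E \<longrightarrow> above T c v) \<and>
    (conn U \<longrightarrow> E \<inter> (- K) \<times> (- K) = {} \<longrightarrow> height T \<le> Suc (card (U \<inter> K)))"
  using assms
proof (induction U rule: finite_psubset_induct)
  case (psubset U)
  obtain r where r: "r \<in> U" "U \<inter> K \<noteq> {} \<longrightarrow> r \<in> K"
    using psubset.prems by blast
  let ?Cs = "comps (U - {r})"
  define Q where "Q C T \<longleftrightarrow> st C T \<and>
    (\<forall>c \<in> C \<inter> K. \<forall>v \<in> C - K. (c, v) \<in> E \<longrightarrow> above T c v) \<and>
    (conn C \<longrightarrow> E \<inter> (- K) \<times> (- K) = {} \<longrightarrow> height T \<le> Suc (card (C \<inter> K)))" for C T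
  have "\<exists>T. Q C T" if "C \<in> ?Cs" for C
    unfolding Q_def using psubset.IH[of C] compsD(1)[OF that] compsD(4)[OF that] r(1) by blast
  then obtain t where t: "\<And>C. C \<in> ?Cs \<Longrightarrow> Q C (t C)" by metis
  have st: "st C (t C)" if "C \<in> ?Cs" for C
    using t[OF that] by (simp add: Q_def)
  have ab: "above (t C) c v" if "C \<in> ?Cs" "c \<in> C \<inter> K" "v \<in> C - K" "(c, v) \<in> E" for C c v
    using t[OF that(1)] that(2-) unfolding Q_def by blast
  have ht: "height (t C) \<le> Suc (card (C \<inter> K))" if "C \<in> ?Cs" "E \<inter> (- K) \<times> (- K) = {}" for C
    using t[OF that(1)] compsD(2)[OF that(1)] that(2) unfolding Q_def by blast
  let ?T = "join r t ?Cs"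
  have tj: "tubes ?T = insert U (\<Union>C \<in> ?Cs. tubes (t C))"
    by (rule tubes_join[OF psubset.hyps r(1) st])
  have above: "above ?T c v" if cv: "c \<in> U \<inter> K" "v \<in> U - K" "(c, v) \<in> E" for c v
  proof -
    \<comment> \<open>As \<open>c\<close> lies in \<open>K\<close>, the root is taken from
      \<open>K\<close>; it therefore differs from \<open>v\<close>, and \<open>v\<close> lies in a
      component below it.\<close>
    have "r \<in> K" using r cv by blast
    then obtain C where C: "C \<in> ?Cs" "v \<in> C" using comps_cover[of v "U - {r}"] cv by blast
    show ?thesis
    proof (cases "c = r")
      case True
      have "C \<in> tubes (t C)" using tree_verts_st[OF st[OF C(1)]] by (cases "t C") auto
      moreover have "c \<notin> C" using compsD(1)[OF C(1)] True by blast
      ultimately show ?thesis using C unfolding above_def tj by blast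
    next
      case False
      then have "c \<in> C" using comps_edge[OF C, of c] cv symD[OF sym_E] by blast
      then show ?thesis using ab[OF C(1), of c v] C cv unfolding above_def tj by blast
    qed
  qed
  have height: "height ?T \<le> Suc (card (U \<inter> K))" if "conn U" and ind: "E \<inter> (- K) \<times> (- K) = {}"
  proof -
    \<comment> \<open>A connected set avoiding \<open>K\<close> spans no edge, so it is a single
      vertex with nothing below the root. Otherwise \<open>r\<close> lies in \<open>K\<close>, and
      its loss from the count pays for the new level.\<close>
    have "height (t C) \<le> card (U \<inter> K)" if C: "C \<in> ?Cs" for C
    proof (cases "U \<inter> K = {}")
      case True
      have "{r} = U" using r True ind by (intro connD[OF \<open>conn U\<close>]) auto
      then show ?thesis using C comps_empty by auto
    next
      case False
      then have "C \<inter> K \<subset> U \<inter> K" using r compsD(1)[OF C] by blast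
      then have "card (C \<inter> K) < card (U \<inter> K)" using psubset.hyps by (intro psubset_card_mono) auto
      then show ?thesis using ht[OF C ind] by linarith
    qed
    then show ?thesis using psubset.hyps finite_comps[of "U - {r}"] by (simp add: height_join)
  qed
  show ?case using st_joinI[OF psubset.hyps r(1) st] above height by blast
qed

section \<open>Distances and diameter of the rotation graph\<close>

lemma walk_iff_relpow: "(\<exists>p. set p \<subseteq> A \<and> pcas u p v \<and> length p = k) \<longleftrightarrow> (u, v) \<in> A ^^ k"
proof (induction k arbitrary: u)
  case (Suc k)
  have "(u, v) \<in> A ^^ Suc k \<longleftrightarrow> (\<exists>w. (u, w) \<in> A \<and> (w, v) \<in> A ^^ k)"
    by (meson relpow_Suc_D2 relpow_Suc_I2)
  also have "\<dots> \<longleftrightarrow> (\<exists>w. (u, w) \<in> A \<and> (\<exists>p. set p \<subseteq> A \<and> pcas w p v \<and> length p = k))"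
    using Suc.IH by simp
  also have "\<dots> \<longleftrightarrow> (\<exists>p. set p \<subseteq> A \<and> pcas u p v \<and> length p = Suc k)"
    by (auto simp: length_Suc_conv) (metis insert_subset list.simps(15) pcas.simps(2) fst_conv snd_conv length_Cons)+
  finally show ?case by simp
qed auto

lemma graph_distance_rotation_graph:
  assumes "st U S"
  shows "graph_distance (with_proj (rotation_graph (induced U))) S T = (LEAST k. (S, T) \<in> rot U ^^ k)"
proof -
  have "parcs (rotation_graph (induced U)) = rot U"
    by (simp add: rotation_graph_def rot_def)
  moreover have "S \<in> pverts (rotation_graph (induced U))"
    using assms by (simp add: rotation_graph_def)
  ultimately show ?thesis
    unfolding graph_distance_def pre_digraph.awalk_def cas_with_proj_eq
    by (simp add: walk_iff_relpow)
qed

text \<open>The factor 2 comes from the detour through a tree \<open>T0\<close> of minimum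
  height.\<close>

lemma distance_upper:
  assumes "finite U" "st U S" "st U T"
  shows "graph_distance (with_proj (rotation_graph (induced U))) S T \<le> 2 * tree_depth (induced U) * card U"
proof -
  have "\<exists>h. \<exists>T. st U T \<and> height T = h" using assms by blast
  from LeastI_ex[OF this] obtain T0 where T0: "st U T0" "height T0 = tree_depth (induced U)"
    unfolding tree_depth_def by blast
  have "reach U (height T0 * card U + height T0 * card U) S T"
    using reach_trans reach_height[OF assms(1) T0(1) assms(2)]
      reach_sym[OF reach_height[OF assms(1) T0(1) assms(3)]] by blast
  moreover have "height T0 * card U + height T0 * card U = 2 * tree_depth (induced U) * card U"
    by (simp add: T0)
  ultimately obtain k where "k \<le> 2 * tree_depth (induced U) * card U" "(S, T) \<in> rot U ^^ k"
    unfolding reach_def by auto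
  then show ?thesis
    unfolding graph_distance_rotation_graph[OF assms(2)] by (meson Least_le order_trans)
qed

lemma distance_lower:
  assumes "finite U" "st U S" "st U T"
  shows "card (flips U S T) \<le> graph_distance (with_proj (rotation_graph (induced U))) S T"
proof -
  \<comment> \<open>The \<open>LEAST\<close> in the distance is attained only once some walk from
    \<open>S\<close> to \<open>T\<close> is known to exist.\<close>
  have "\<exists>k. (S, T) \<in> rot U ^^ k"
    using reach_height[OF assms(1,3,2)] by (auto simp: reach_def)
  then have "(S, T) \<in> rot U ^^ (LEAST k. (S, T) \<in> rot U ^^ k)" by (rule LeastI_ex)
  then show ?thesis
    unfolding graph_distance_rotation_graph[OF assms(2)] using card_flips_le assms by blast
qed

lemma diameter_bounds:
  assumes "finite U" "U \<noteq> {}"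
  shows "associahedron_diameter (induced U) \<le> 2 * tree_depth (induced U) * card U"
    and "st U S \<Longrightarrow> st U T \<Longrightarrow> card (flips U S T) \<le> associahedron_diameter (induced U)"
proof -
  let ?d = "graph_distance (with_proj (rotation_graph (induced U)))"
  let ?D = "{?d S T | S T. st U S \<and> st U T}"
  have D: "associahedron_diameter (induced U) = Max ?D"
    by (simp add: associahedron_diameter_def graph_diameter_def rotation_graph_def)
  have bound: "d \<le> 2 * tree_depth (induced U) * card U" if "d \<in> ?D" for d
    using that distance_upper[OF assms(1)] by blast
  \<comment> \<open>\<open>Max\<close> needs a finite set; the uniform bound on distances provides
    this without counting search trees.\<close>
  then have fin: "finite ?D" using finite_nat_set_iff_bounded_le by blast
  have "?D \<noteq> {}" using search_tree_exists[OF assms] by blast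
  then show "associahedron_diameter (induced U) \<le> 2 * tree_depth (induced U) * card U"
    unfolding D using bound fin by (intro Max.boundedI) blast+
  show "card (flips U S T) \<le> associahedron_diameter (induced U)" if "st U S" "st U T"
    unfolding D using distance_lower[OF assms(1) that] Max_ge[OF fin, of "?d S T"] that
    by fastforce
qed

lemma pair_graph_induced:
  assumes "pair_graph G" "parcs G = E"
  shows "with_proj G = induced (pverts G)"
proof -
  interpret pair_graph G by fact
  show ?thesis using assms(2) in_arcsD1 in_arcsD2
    by (auto simp: with_proj_def induced_def)
qed

end

lemma associahedron_diameter_le:
  assumes "pair_graph G" "pverts G \<noteq> {}"
  shows "associahedron_diameter (with_proj G) \<le> 2 * tree_depth (with_proj G) * card (pverts G)"
proof -
  interpret G: pair_graph G by fact
  interpret undirected "parcs G"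
    using G.pair_sym_arcs by unfold_locales (simp add: symmetric_def)
  show ?thesis
    using diameter_bounds(1)[OF G.pair_finite_verts assms(2)] pair_graph_induced[OF assms(1)] by simp
qed

section \<open>Complete split graphs and the asymptotic bound\<close>

definition complete_split :: "nat \<Rightarrow> nat \<Rightarrow> nat pair_pre_digraph" where
  "complete_split n k = \<lparr>pverts = {..<n},
     parcs = {(i, j). i < n \<and> j < n \<and> i \<noteq> j \<and> (i < k \<or> j < k)}\<rparr>"

lemma pair_graph_complete_split: "pair_graph (complete_split n k)"
proof
  show "finite (parcs (complete_split n k))"
    by (rule finite_subset[of _ "{..<n} \<times> {..<n}"]) (auto simp: complete_split_def)
qed (auto simp: complete_split_def symmetric_def sym_def)

lemma complete_split:
  assumes k: "1 \<le> k" "k \<le> n"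
  shows "connected (with_proj (complete_split n k))"
    and "tree_depth (with_proj (complete_split n k)) \<le> Suc k"
    and "k * (n - k) \<le> associahedron_diameter (with_proj (complete_split n k))"
proof -
  let ?G = "complete_split n k" let ?U = "{..<n}" let ?K = "{..<k}"
  interpret G: pair_graph ?G by (rule pair_graph_complete_split)
  interpret undirected "parcs ?G"
    using G.pair_sym_arcs by unfold_locales (simp add: symmetric_def)
  have U: "pverts ?G = ?U" "finite ?U" "?U \<noteq> {}"
    using k by (auto simp: complete_split_def lessThan_empty_iff)
  have G: "with_proj ?G = induced ?U" using pair_graph_induced[OF pair_graph_complete_split] U by simp
  have conn: "conn ?U" unfolding conn_def
  proof (intro conjI allI impI)
    fix A assume A: "A \<subseteq> ?U" "A \<noteq> {}" "parcs ?G `` A \<inter> ?U \<subseteq> A"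
    \<comment> \<open>Since \<open>1 \<le> k\<close>, vertex 0 is in the clique and adjacent to
      every other vertex; a nonempty closed set thus contains 0 and then everything.\<close>
    have cl: "j \<in> A" if "i \<in> A" "j < n" "i = 0 \<or> j = 0" for i j
    proof -
      have "i < n" using A(1) that(1) by blast
      then have "i = j \<or> (i, j) \<in> parcs ?G" using that k by (auto simp: complete_split_def)
      then show ?thesis using that A(3) by blast
    qed
    obtain a where "a \<in> A" using A by blast
    then have "0 \<in> A" using cl k by simp
    then show "A = ?U" using cl A by blast
  qed (use U in simp)
  then have "strongly_connected (with_proj ?G)" unfolding G strongly_connected_induced .
  then show "connected (with_proj ?G)"
    by (simp add: connected_def strongly_connected_def G.reachable_mk_symmetricI)
  obtain S where S: "st ?U S" "\<And>c v. c \<in> ?U \<inter> ?K \<Longrightarrow> v \<in> ?U - ?K \<Longrightarrow> (c, v) \<in> parcs ?G \<Longrightarrow> above S c v"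
    "height S \<le> Suc (card (?U \<inter> ?K))"
    using search_tree_exists[OF U(2,3), of ?K] conn by (auto simp: complete_split_def)
  \<comment> \<open>Taking \<open>- ?K\<close> for \<open>K\<close> puts the independent vertices
    above the clique, so every edge between the two parts is flipped between \<open>S\<close> and
    \<open>T\<close>.\<close>
  obtain T where T: "st ?U T"
    "\<And>c v. c \<in> ?U \<inter> - ?K \<Longrightarrow> v \<in> ?U - (- ?K) \<Longrightarrow> (c, v) \<in> parcs ?G \<Longrightarrow> above T c v"
    using search_tree_exists[OF U(2,3), of "- ?K"] by blast
  have "tree_depth (with_proj ?G) \<le> height S"
    unfolding tree_depth_def G using S(1) by (intro Least_le) blast
  also have "\<dots> \<le> Suc k" using S(3) k by (simp add: Int_absorb1 lessThan_subset_iff)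
  finally show "tree_depth (with_proj ?G) \<le> Suc k" .
  have "?K \<times> {k..<n} \<subseteq> flips ?U S T"
  proof
    fix p assume "p \<in> ?K \<times> {k..<n}"
    then obtain c v where p: "p = (c, v)" "c < k" "k \<le> v" "v < n" by auto
    then have "(c, v) \<in> parcs ?G" "(v, c) \<in> parcs ?G" by (auto simp: complete_split_def)
    then show "p \<in> flips ?U S T" using p S(2)[of c v] T(2)[of v c] by (auto simp: flips_def)
  qed
  then have "card (?K \<times> {k..<n}) \<le> card (flips ?U S T)"
    using finite_flips U(2) by (intro card_mono) auto
  then show "k * (n - k) \<le> associahedron_diameter (with_proj ?G)"
    using diameter_bounds(2)[OF U(2,3) S(1) T(1)] unfolding G by (simp add: card_cartesian_product)
qed

text \<open>The hypotheses delimit the meaningful range: for \<open>2 \<le> n\<close> no connected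
  graph of order \<open>n\<close> has tree-depth below 2, and none has tree-depth above
  \<open>n\<close>. The constant 6 comes from multiplying \<open>td n \<le> 3 * real k\<close> and
  \<open>real n \<le> 2 * real (n - k)\<close>.\<close>

lemma max_diameter_bounds:
  fixes td :: "nat \<Rightarrow> real"
  assumes n: "2 \<le> td n" "td n \<le> real n"
  shows "real (max_diameter td n) \<le> 2 * (td n * real n)"
    and "td n * real n \<le> 6 * real (max_diameter td n)"
proof -
  let ?P = "\<lambda>G :: nat pair_pre_digraph. pair_graph G \<and> connected (with_proj G) \<and>
    real (tree_depth (with_proj G)) \<le> td n \<and> card (pverts G) = n"
  define M where "M = {associahedron_diameter (with_proj G) | G. ?P G}"
  have max: "max_diameter td n = Max M" unfolding M_def max_diameter_def by (rule refl)
  have bound: "real d \<le> 2 * (td n * real n)" if "d \<in> M" for d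
  proof -
    from that obtain G where G: "?P G" "d = associahedron_diameter (with_proj G)"
      unfolding M_def by blast
    then have "pverts G \<noteq> {}" using n by auto
    then have "d \<le> 2 * tree_depth (with_proj G) * n" using associahedron_diameter_le G by blast
    then have "real d \<le> 2 * real (tree_depth (with_proj G)) * real n"
      by (metis of_nat_le_iff of_nat_mult of_nat_numeral)
    also have "\<dots> \<le> 2 * td n * real n" using G n by (intro mult_right_mono mult_left_mono) auto
    finally show ?thesis by simp
  qed
  have "d \<le> nat \<lfloor>2 * (td n * real n)\<rfloor>" if "d \<in> M" for d
    by (rule le_nat_floor[OF bound[OF that]])
  then have fin: "finite M" using finite_nat_set_iff_bounded_le by blast
  \<comment> \<open>The bound \<open>k + 1\<close> on the tree-depth must not exceed
    \<open>td n\<close>, hence the subtraction of 1; the cap \<open>n div 2\<close> keeps at least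
    half of the vertices independent.\<close>
  define k where "k = min (nat \<lfloor>td n\<rfloor> - 1) (n div 2)"
  have fl: "real (nat \<lfloor>td n\<rfloor>) \<le> td n" "td n < real (nat \<lfloor>td n\<rfloor>) + 1" "2 \<le> nat \<lfloor>td n\<rfloor>"
    using n by (simp_all add: le_nat_floor)
  have n2: "2 \<le> n" using n by linarith
  then have k: "1 \<le> k" "k \<le> n" "real (Suc k) \<le> td n" "2 * k \<le> n"
    using fl by (auto simp: k_def min_def)
  \<comment> \<open>In the first case \<open>td n < k + 2\<close> and \<open>1 \<le> k\<close>; in
    the second \<open>k = n div 2\<close>, and \<open>2 \<le> n\<close> gives
    \<open>n \<le> 3 * k\<close>.\<close>
  have "td n \<le> 3 * real k"
  proof (cases "nat \<lfloor>td n\<rfloor> - 1 \<le> n div 2")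
    case True
    then have "real k = real (nat \<lfloor>td n\<rfloor>) - 1" using fl(3) by (simp add: k_def of_nat_diff)
    then show ?thesis using fl by linarith
  next
    case False
    then have "n \<le> 3 * k" using n2 by (simp add: k_def)
    then show ?thesis using n(2) by linarith
  qed
  moreover have "real n \<le> 2 * real (n - k)" using k by linarith
  ultimately have "td n * real n \<le> (3 * real k) * (2 * real (n - k))"
    using n by (intro mult_mono) auto
  also have "\<dots> = 6 * real (k * (n - k))" by simp
  finally have tdk: "td n * real n \<le> 6 * real (k * (n - k))" .
  have mem: "associahedron_diameter (with_proj (complete_split n k)) \<in> M"
    using pair_graph_complete_split[of n k] complete_split(1,2)[OF k(1,2)] k(3)
    unfolding M_def by (intro CollectI exI[of _ "complete_split n k"]) (auto simp: complete_split_def)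
  show "real (max_diameter td n) \<le> 2 * (td n * real n)"
    unfolding max using bound Max_in[OF fin] mem by blast
  have "k * (n - k) \<le> max_diameter td n"
    unfolding max using complete_split(3)[OF k(1,2)] Max_ge[OF fin mem] by linarith
  then have "real (k * (n - k)) \<le> real (max_diameter td n)" by (simp only: of_nat_le_iff)
  then show "td n * real n \<le> 6 * real (max_diameter td n)" using tdk by linarith
qed

theorem theorem4:
  fixes td :: "nat \<Rightarrow> real"
  assumes "\<forall>\<^sub>F n in at_top. 2 \<le> td n \<and> td n \<le> real n"
  shows "(\<lambda>n. real (max_diameter td n)) \<in> \<Theta>(\<lambda>n. td n * real n)"
proof (rule bigthetaI)
  show "(\<lambda>n. real (max_diameter td n)) \<in> O(\<lambda>n. td n * real n)"
    by (rule bigoI[where c = 2], use assms in eventually_elim)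
      (use max_diameter_bounds(1) in \<open>auto simp: abs_mult\<close>)
  show "(\<lambda>n. real (max_diameter td n)) \<in> \<Omega>(\<lambda>n. td n * real n)"
    unfolding bigomega_iff_bigo
    by (rule bigoI[where c = 6], use assms in eventually_elim)
      (use max_diameter_bounds(2) in \<open>auto simp: abs_mult\<close>)
qed

end
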